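(* Let $(x_n)_{n\ge1}$ be a greedy sequence on $\mathbb{S}^2$ (with respect to the sum of Euclidean distances, i.e. the Riesz kernel with $s=-1$) with $m\ge1$ initial points. Then for all $N$ sufficiently large, depending on $m$, $$\frac1{25}\le\frac1N\sum_{n=1}^{N-1}\left(\max_{x\in\mathbb{S}^2}\sum_{i=1}^n\|x-x_i\|-\frac{4n}{3}\right)\le\frac23.$$
   Context: $\mathbb{S}^2\subset\mathbb{R}^3$ is the unit sphere with Euclidean norm $\|\cdot\|$. A greedy sequence (for $s=-1$) with $m$ initial points is a sequence in $\mathbb{S}^2$ whose first $m$ points $x_1,\dots,x_m$ are arbitrary and such that, for every $n\ge m$, $x_{n+1}$ is a maximizer (any one, if not unique) over $x\in\mathbb{S}^2$ of $\sum_{i=1}^n\|x-x_i\|$. *)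

theory Defs
  imports "HOL-Analysis.Analysis"
begin

abbreviation S2 :: "(real ^ 3) set" where
  "S2 \<equiv> sphere 0 1"

text \<open>Sequences are indexed from 1; the value at index 0 is never used.\<close>

definition dist_potential :: "(nat \<Rightarrow> real ^ 3) \<Rightarrow> nat \<Rightarrow> real ^ 3 \<Rightarrow> real" where
  "dist_potential x n y = (\<Sum>i=1..n. norm (y - x i))"

definition greedy_sequence :: "nat \<Rightarrow> (nat \<Rightarrow> real ^ 3) \<Rightarrow> bool" where
  "greedy_sequence m x \<longleftrightarrow>
     (\<forall>n\<ge>1. x n \<in> S2) \<and>
     (\<forall>n\<ge>m. is_arg_max (dist_potential x n) (\<lambda>y. y \<in> S2) (x (n + 1)))"

definition max_potential :: "(nat \<Rightarrow> real ^ 3) \<Rightarrow> nat \<Rightarrow> real" where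
  "max_potential x n = (SUP y\<in>S2. dist_potential x n y)"

text \<open>The supremum is attained, so it is a maximum.\<close>

lemma max_potential_attained:
  obtains y where "y \<in> S2" "max_potential x n = dist_potential x n y"
    "\<And>z. z \<in> S2 \<Longrightarrow> dist_potential x n z \<le> max_potential x n"
proof -
  have "continuous_on S2 (dist_potential x n)"
    unfolding dist_potential_def by (intro continuous_intros)
  moreover have "S2 \<noteq> {}" by simp
  ultimately obtain y where y: "y \<in> S2"
      "\<And>z. z \<in> S2 \<Longrightarrow> dist_potential x n z \<le> dist_potential x n y"
    using continuous_attains_sup[of S2 "dist_potential x n"] compact_sphere by blast
  have "max_potential x n = dist_potential x n y"
    unfolding max_potential_def using y by (intro cSup_eq_maximum) auto
  with y show thesis by (intro that) auto
qed

end

theory Submission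
  imports Defs "HOL-Probability.Probability_Measure"
begin

text \<open>
  Write \<open>\<sigma>\<close> for the normalised surface measure and \<open>\<parallel>x - y\<parallel> = \<surd>2 \<surd>(1 - x \<bullet> y)\<close>. In the power series of
  \<open>-\<surd>(1 - s)\<close> only the constant coefficient is negative, and the kernels \<open>(x \<bullet> y)\<^sup>k\<close> are positive definite;
  hence \<open>4N\<^sup>2/3 - \<Sum>\<^sub>i\<^sub>j \<parallel>x\<^sub>i - x\<^sub>j\<parallel>\<close> is a sum over \<open>k\<close> of nonnegative terms. For even \<open>k\<close> between \<open>2N\<close> and \<open>4N\<close>
  the diagonal \<open>i = j\<close> alone contributes \<open>N\<close> against a mean value \<open>N\<^sup>2/(k + 1) \<le> N/2\<close>, so the deficit is at
  least of order \<open>\<surd>N\<close>. As the potentials at the greedy points add up to half the total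
  energy, this deficit absorbs the bounded error caused by the \<open>m\<close> initial points and gives the upper bound.

  For the lower bound let \<open>d\<^sub>n\<close> be the excess of the maximum of the \<open>n\<close>-th potential \<open>P\<^sub>n\<close> over its mean, and
  \<open>r = \<parallel>\<cdot> - x\<^sub>n\<^sub>+\<^sub>1\<parallel>\<close>. Integrating \<open>r (max P\<^sub>n\<^sub>+\<^sub>1 - P\<^sub>n\<^sub>+\<^sub>1) + (2 - r) (max P\<^sub>n - P\<^sub>n) \<ge> 0\<close> over \<open>\<sigma>\<close> yields
  \<open>(4/3) d\<^sub>n\<^sub>+\<^sub>1 + (2/3) d\<^sub>n \<ge> 2/9\<close>, so \<open>d\<^sub>n\<close> is at least \<open>1/9\<close> on average.
\<close>

section \<open>The power series of the negated square root\<close>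

text \<open>These are the Taylor coefficients of \<open>- sqrt (1 - s)\<close> at 0.\<close>

definition sqrt_coeff :: "nat \<Rightarrow> real" where
  "sqrt_coeff k = (-1) ^ Suc k * (1/2 gchoose k)"

lemma sqrt_coeff_Suc: "sqrt_coeff (Suc k) = sqrt_coeff k * (real k - 1/2) / real (Suc k)"
proof -
  have "real (Suc k) * ((1/2::real) gchoose Suc k) = (1/2 - real k) * ((1/2::real) gchoose k)"
    using gbinomial_mult_1[of "1/2::real" k] by (simp add: algebra_simps)
  then have "((1/2::real) gchoose Suc k) = (1/2 - real k) * ((1/2::real) gchoose k) / real (Suc k)"
    by (simp add: eq_divide_eq mult.commute)
  then show ?thesis
    unfolding sqrt_coeff_def by (simp only: power_Suc) (simp add: divide_simps, simp add: algebra_simps)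
qed

lemma sqrt_coeff_0: "sqrt_coeff 0 = -1"
  by (simp add: sqrt_coeff_def)

lemma sqrt_coeff_1: "sqrt_coeff (Suc 0) = 1/2"
  by (simp add: sqrt_coeff_Suc sqrt_coeff_0)

lemma sqrt_coeff_nonneg: "0 \<le> sqrt_coeff (Suc k)"
proof (induction k)
  case (Suc k)
  then show ?case
    unfolding sqrt_coeff_Suc[of "Suc k"] by simp
qed (simp add: sqrt_coeff_1)

text \<open>The recursion makes the sum telescope. What matters is the sign of the closed form: no
  partial sum is positive, so the positive coefficients add up to at most 1.\<close>

lemma sum_sqrt_coeff: "(\<Sum>k\<le>n. sqrt_coeff k) = - 2 * real (Suc n) * sqrt_coeff (Suc n)"
proof (induction n)
  case (Suc n)
  have "real (Suc (Suc n)) * sqrt_coeff (Suc (Suc n)) = sqrt_coeff (Suc n) * (real (Suc n) - 1/2)"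
    unfolding sqrt_coeff_Suc[of "Suc n"] by simp
  then show ?case
    using Suc by (simp add: algebra_simps)
qed (simp add: sqrt_coeff_0 sqrt_coeff_1)

lemma summable_sqrt_coeff: "summable (\<lambda>k. \<bar>sqrt_coeff k\<bar>)"
proof (rule bounded_imp_summable)
  fix n
  have "(\<Sum>k\<le>n. \<bar>sqrt_coeff k\<bar>) = (\<Sum>k\<le>n. sqrt_coeff k) + 2"
    by (simp add: sum.atMost_shift sqrt_coeff_0 sqrt_coeff_nonneg)
  also have "\<dots> \<le> 2"
    unfolding sum_sqrt_coeff using sqrt_coeff_nonneg[of n] by (simp add: mult_nonpos_nonneg)
  finally show "(\<Sum>k\<le>n. \<bar>sqrt_coeff k\<bar>) \<le> 2" .
qed simp

text \<open>The coefficients decay like \<open>k powr (-3/2)\<close>; squaring avoids roots.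
  Replacing one factor \<open>k\<close> by \<open>k - 1\<close> makes the claim inductive: the step
  reduces to \<open>(k - 1) * k \<le> (k - 1/2)^2\<close>, and \<open>k = 2\<close> gives
  equality.\<close>

lemma sqrt_coeff_lower:
  assumes "k \<ge> 1"
  shows "1 \<le> 16 * real k ^ 3 * (sqrt_coeff k)\<^sup>2"
proof -
  have *: "1 \<le> 16 * (real k - 1) * real k ^ 2 * (sqrt_coeff k)\<^sup>2" if "k \<ge> 2" for k
    using that
  proof (induction k rule: dec_induct)
    case base
    have "sqrt_coeff 2 = 1/8"
      using sqrt_coeff_Suc[of 1] by (simp add: sqrt_coeff_1 numeral_2_eq_2)
    then show ?case by (simp only: power2_eq_square) simp
  next
    case (step k)
    have "real (Suc k) * sqrt_coeff (Suc k) = (real k - 1/2) * sqrt_coeff k"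
      unfolding sqrt_coeff_Suc by simp
    then have eq: "(real (Suc k))\<^sup>2 * (sqrt_coeff (Suc k))\<^sup>2 = (real k - 1/2)\<^sup>2 * (sqrt_coeff k)\<^sup>2"
      by (metis power_mult_distrib)
    have "1 \<le> 16 * (real k - 1) * real k ^ 2 * (sqrt_coeff k)\<^sup>2"
      by (rule step.IH)
    also have "\<dots> = 16 * real k * ((real k - 1) * real k * (sqrt_coeff k)\<^sup>2)"
      by (simp add: power2_eq_square)
    also have "\<dots> \<le> 16 * real k * ((real k - 1/2)\<^sup>2 * (sqrt_coeff k)\<^sup>2)"
      by (intro mult_left_mono mult_right_mono) (simp_all add: power2_eq_square algebra_simps)
    also have "\<dots> = 16 * (real (Suc k) - 1) * real (Suc k) ^ 2 * (sqrt_coeff (Suc k))\<^sup>2"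
      unfolding eq[symmetric] by simp
    finally show ?case .
  qed
  show ?thesis
  proof (cases "k = 1")
    case False
    then have "1 \<le> 16 * (real k - 1) * real k ^ 2 * (sqrt_coeff k)\<^sup>2"
      using assms by (intro *) simp
    also have "\<dots> \<le> 16 * real k * real k ^ 2 * (sqrt_coeff k)\<^sup>2"
      by (intro mult_right_mono) simp_all
    finally show ?thesis
      by (simp add: power3_eq_cube power2_eq_square mult.assoc)
  qed (simp add: sqrt_coeff_1 power2_eq_square)
qed

text \<open>The binomial series covers the open interval. The M-test makes the series continuous on
  the closed one, which adds the endpoints; \<open>s = 1\<close> occurs for coinciding
  points.\<close>

lemma sqrt_coeff_sums:
  assumes "\<bar>s\<bar> \<le> 1"
  shows "(\<lambda>k. sqrt_coeff k * s ^ k) sums (- sqrt (1 - s))"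
proof -
  let ?F = "\<lambda>s. \<Sum>k. sqrt_coeff k * s ^ k"
  have bnd: "norm (sqrt_coeff k * s ^ k) \<le> \<bar>sqrt_coeff k\<bar>" if "s \<in> {-1..1}" for k s
    using that by (auto simp: abs_mult power_abs intro!: mult_left_le power_le_one)
  have summable: "summable (\<lambda>k. sqrt_coeff k * s ^ k)" if "s \<in> {-1..1}" for s
    by (rule summable_comparison_test'[OF summable_sqrt_coeff, of 0]) (rule bnd[OF that])
  have "uniform_limit {-1..1} (\<lambda>n s. \<Sum>k<n. sqrt_coeff k * s ^ k) ?F sequentially"
    using bnd summable_sqrt_coeff by (rule Weierstrass_m_test)
  then have "continuous_on {-1..1} ?F"
    by (rule uniform_limit_theorem[rotated]) (auto intro!: always_eventually continuous_intros)
  then have "continuous_on (closure {-1<..<1}) (\<lambda>s. ?F s + sqrt (1 - s))"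
    by (auto intro!: continuous_intros)
  moreover have "?F s + sqrt (1 - s) = 0" if "s \<in> {-1<..<1}" for s
  proof -
    have "(\<lambda>k. - ((1/2 gchoose k) * (- s) ^ k)) sums - sqrt (1 + - s)"
      by (intro sums_minus sqrt_series) (use that in auto)
    also have "(\<lambda>k. - ((1/2 gchoose k) * (- s) ^ k)) = (\<lambda>k. sqrt_coeff k * s ^ k)"
      by (simp add: sqrt_coeff_def fun_eq_iff power_minus[of s] mult.commute)
    finally show ?thesis
      by (simp add: sums_iff)
  qed
  ultimately have "?F s + sqrt (1 - s) = 0"
    by (rule continuous_constant_on_closure) (use assms in auto)
  then show ?thesis
    using summable_sums[OF summable[of s]] assms by (simp add: add_eq_0_iff2 abs_le_iff)
qed

text \<open>Termwise integration, justified by absolute summability of the coefficients. It serves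
  both the uniform distribution on \<open>{-1..1}\<close> and the sphere.\<close>

lemma moment_series:
  fixes X :: "'a \<Rightarrow> real"
  assumes M: "prob_space M" and X[measurable]: "X \<in> borel_measurable M"
    and bound: "AE u in M. \<bar>X u\<bar> \<le> 1"
  shows "(\<lambda>k. sqrt_coeff k * (\<integral>u. X u ^ k \<partial>M)) sums (\<integral>u. - sqrt (1 - X u) \<partial>M)"
proof -
  interpret prob_space M by (rule M)
  have int: "integrable M (\<lambda>u. X u ^ k)" for k
    by (rule integrable_const_bound[where B=1])
      (use bound in \<open>auto elim!: eventually_mono simp: power_abs power_le_one\<close>)
  have "(\<lambda>k. \<integral>u. sqrt_coeff k * X u ^ k \<partial>M) sums (\<integral>u. (\<Sum>k. sqrt_coeff k * X u ^ k) \<partial>M)"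
  proof (rule sums_integral)
    show "integrable M (\<lambda>u. sqrt_coeff k * X u ^ k)" for k
      using int by simp
    show "AE u in M. summable (\<lambda>k. norm (sqrt_coeff k * X u ^ k))"
      using bound
    proof eventually_elim
      case (elim u)
      show ?case
        by (rule summable_comparison_test'[OF summable_sqrt_coeff, of 0])
          (use elim in \<open>simp add: abs_mult power_abs mult_left_le power_le_one\<close>)
    qed
    have "(\<integral>u. norm (sqrt_coeff k * X u ^ k) \<partial>M) \<le> (\<integral>u. \<bar>sqrt_coeff k\<bar> \<partial>M)" for k
    proof (rule integral_mono_AE)
      show "AE u in M. norm (sqrt_coeff k * X u ^ k) \<le> \<bar>sqrt_coeff k\<bar>"
        using bound by eventually_elim (simp add: abs_mult power_abs mult_left_le power_le_one)
    qed (use int in simp_all)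
    then show "summable (\<lambda>k. \<integral>u. norm (sqrt_coeff k * X u ^ k) \<partial>M)"
      by (intro summable_comparison_test'[OF summable_sqrt_coeff, of 0]) (simp add: prob_space)
  qed
  also have "(\<integral>u. (\<Sum>k. sqrt_coeff k * X u ^ k) \<partial>M) = (\<integral>u. - sqrt (1 - X u) \<partial>M)"
    by (rule integral_cong_AE)
      (use bound in \<open>auto elim!: eventually_mono dest: sqrt_coeff_sums simp: sums_iff\<close>)
  finally show ?thesis
    by simp
qed

text \<open>The factors after \<open>sqrt_coeff k\<close> are the moments of the uniform
  distribution on \<open>{-1..1}\<close>, so the sum is the mean of \<open>- sqrt (1 - s)\<close>,
  which has an explicit primitive.\<close>

lemma uniform_moment_series:
  "(\<lambda>k. sqrt_coeff k * (if even k then 1 / real (Suc k) else 0)) sums (- 4 / (3 * sqrt 2))"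
proof -
  let ?M = "uniform_measure lborel {-1..1::real}"
  have M: "prob_space ?M"
    by (rule prob_space_uniform_measure) simp_all
  \<comment> \<open>The derivative is required in the interior only, since
    \<open>sqrt (1 - s)\<close> is not differentiable at 1.\<close>
  have int: "(\<integral>s. f s \<partial>?M) = (F 1 - F (-1)) / 2"
    if f: "continuous_on {-1..1} f" and [measurable]: "f \<in> borel_measurable borel"
      and F: "continuous_on {-1..1} F"
      and deriv: "\<And>s. -1 < s \<Longrightarrow> s < 1 \<Longrightarrow> (F has_real_derivative f s) (at s)" for f F :: "real \<Rightarrow> real"
  proof -
    have "(\<integral>s. f s \<partial>?M) = (\<integral>s. (indicator {-1..1} s / 2) *\<^sub>R f s \<partial>lborel)"
      unfolding uniform_measure_def
      by (subst integral_density[symmetric])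
        (auto simp: ennreal_indicator[symmetric] divide_ennreal simp flip: ennreal_numeral)
    also have "\<dots> = (LINT s:{-1..1}|lborel. f s) / 2"
      by (simp add: set_lebesgue_integral_def)
    also have "(LINT s:{-1..1}|lborel. f s) = integral {-1..1} f"
      by (intro set_borel_integral_eq_integral borel_integrable_atLeastAtMost' f)
    also have "\<dots> = F 1 - F (-1)"
      by (intro integral_unique fundamental_theorem_of_calculus_interior F)
        (use deriv in \<open>auto simp: has_real_derivative_iff_has_vector_derivative\<close>)
    finally show ?thesis .
  qed
  have "(\<lambda>k. sqrt_coeff k * (\<integral>s. s ^ k \<partial>?M)) sums (\<integral>s. - sqrt (1 - s) \<partial>?M)"
    by (rule moment_series[OF M]) (auto intro!: AE_uniform_measureI simp: abs_le_iff)
  moreover have "(\<integral>s. s ^ k \<partial>?M) = (if even k then 1 / real (Suc k) else 0)" for k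
    by (subst int[where F="\<lambda>s. s ^ Suc k / real (Suc k)"])
      (auto intro!: continuous_intros derivative_eq_intros simp: field_simps simp del: power_Suc of_nat_Suc)
  moreover have "sqrt (1 - s) * (sqrt (1 - s) * 9) = 9 - 9 * s" if "s < 1" for s
    using that by (simp flip: mult.assoc)
  then have "(\<integral>s. - sqrt (1 - s) \<partial>?M) = - 4 / (3 * sqrt 2)"
    by (subst int[where F="\<lambda>s. 2/3 * ((1 - s) * sqrt (1 - s))"])
      (auto intro!: continuous_intros derivative_eq_intros simp: field_simps)
  ultimately show ?thesis
    by simp
qed

section \<open>The uniform probability measure on the sphere\<close>

text \<open>Radial projection of the uniform distribution on the ball, so that rotation invariance
  is inherited from Lebesgue measure. It lives on all of \<open>real ^ 3\<close>; facts about unit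
  vectors therefore hold almost everywhere.\<close>

definition sphere_measure :: "(real ^ 3) measure" where
  "sphere_measure = distr (uniform_measure lborel (ball 0 1)) borel sgn"

lemma sets_sphere_measure [simp, measurable_cong]: "sets sphere_measure = sets borel"
  and space_sphere_measure [simp]: "space sphere_measure = UNIV"
  by (simp_all add: sphere_measure_def)

lemma borel_measurable_sgn [measurable]: "(sgn :: real ^ 3 \<Rightarrow> real ^ 3) \<in> borel_measurable borel"
  unfolding sgn_div_norm[abs_def] by measurable

lemma emeasure_unit_ball:
  "emeasure lborel (ball (0 :: real ^ 3) 1) \<noteq> 0"
  "emeasure lborel (ball (0 :: real ^ 3) 1) \<noteq> \<infinity>"
  using content_ball_pos[of 1 "0 :: real ^ 3"]
  by (auto simp: measure_def emeasure_lborel_ball_finite less_top[symmetric])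

interpretation sphere_measure: prob_space sphere_measure
  unfolding sphere_measure_def
  by (intro prob_space.prob_space_distr prob_space_uniform_measure)
    (use emeasure_unit_ball in \<open>simp_all add: measurable_cong_sets[OF sets_uniform_measure refl]\<close>)

lemma AE_sphere_measure: "AE u in sphere_measure. norm u = 1"
proof -
  have "AE u in lborel. u \<noteq> (0 :: real ^ 3)"
    by (rule AE_lborel_singleton)
  then show ?thesis
    unfolding sphere_measure_def
    by (subst AE_distr_iff)
      (auto intro!: AE_uniform_measureI simp: norm_sgn elim!: eventually_mono)
qed

lemma borel_measurable_orthogonal:
  fixes R :: "'a::euclidean_space \<Rightarrow> 'a"
  assumes "orthogonal_transformation R"
  shows "R \<in> borel_measurable borel"
  using orthogonal_transformation_linear[OF assms]
  by (intro borel_measurable_continuous_onI linear_continuous_on) (simp add: linear_conv_bounded_linear)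

text \<open>Orthogonal maps preserve both Lebesgue measure and the ball.\<close>

lemma distr_uniform_ball_orthogonal:
  fixes R :: "real ^ 3 \<Rightarrow> real ^ 3"
  assumes R: "orthogonal_transformation R"
  shows "distr (uniform_measure lborel (ball 0 1)) borel R = uniform_measure lborel (ball 0 1)"
proof (rule measure_eqI)
  have [measurable]: "R \<in> borel_measurable borel"
    using R by (intro borel_measurable_orthogonal)
  fix A :: "(real ^ 3) set"
  assume "A \<in> sets (distr (uniform_measure lborel (ball 0 1)) borel R)"
  then have [measurable]: "A \<in> sets borel" by simp
  have RA [measurable]: "R -` A \<in> sets borel"
    using measurable_sets[of R borel borel A] by simp
  have "emeasure lborel (ball 0 1 \<inter> R -` A) = emeasure lborel (ball 0 1 \<inter> A)"
  proof -
    have meas: "ball 0 1 \<inter> B \<in> lmeasurable" if "B \<in> sets borel" for B :: "(real ^ 3) set"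
      using that by (intro bounded_set_imp_lmeasurable bounded_Int) auto
    have im: "R ` (ball 0 1 \<inter> R -` A) = ball 0 1 \<inter> A"
    proof -
      have "R ` (ball 0 1 \<inter> R -` A) = R ` ball 0 1 \<inter> A"
        by blast
      also have "R ` ball 0 1 = ball (R 0) 1"
        by (rule image_orthogonal_transformation_ball[OF R])
      also have "R 0 = 0"
        using R by (simp add: linear_0 orthogonal_transformation_linear)
      finally show ?thesis .
    qed
    have "measure lebesgue (ball 0 1 \<inter> A) = measure lebesgue (ball 0 1 \<inter> R -` A)"
      using measure_orthogonal_image[OF R meas[OF RA]] im by simp
    then have "emeasure lebesgue (ball 0 1 \<inter> A) = emeasure lebesgue (ball 0 1 \<inter> R -` A)"
      by (simp add: emeasure_eq_measure2 meas RA)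
    then show ?thesis
      using RA by simp
  qed
  then show "emeasure (distr (uniform_measure lborel (ball 0 1)) borel R) A =
      emeasure (uniform_measure lborel (ball 0 1)) A"
    by (subst emeasure_distr) (simp_all add: RA)
qed simp

text \<open>Orthogonal maps are linear and preserve norms, hence commute with
  \<open>sgn\<close>.\<close>

lemma distr_sphere_measure_orthogonal:
  assumes R: "orthogonal_transformation R"
  shows "distr sphere_measure borel R = sphere_measure"
proof -
  have [measurable]: "R \<in> borel_measurable borel"
    using R by (intro borel_measurable_orthogonal)
  let ?U = "uniform_measure lborel (ball 0 1) :: (real ^ 3) measure"
  have "R \<circ> sgn = sgn \<circ> R"
    using R by (simp add: fun_eq_iff sgn_div_norm orthogonal_transformation linear_scale)
  then have "distr sphere_measure borel R = distr (distr ?U borel R) borel sgn"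
    unfolding sphere_measure_def by (simp add: distr_distr)
  then show ?thesis
    by (simp add: distr_uniform_ball_orthogonal[OF R] sphere_measure_def)
qed

text \<open>Some orthogonal map carries \<open>x\<close> to \<open>y\<close>, and the measure is
  invariant under it.\<close>

lemma integral_sphere_measure_inner_cong:
  fixes g :: "real \<Rightarrow> real"
  assumes [measurable]: "g \<in> borel_measurable borel" and "norm x = norm y"
  shows "(\<integral>u. g (u \<bullet> x) \<partial>sphere_measure) = (\<integral>u. g (u \<bullet> y) \<partial>sphere_measure)"
proof -
  obtain R where R: "orthogonal_transformation R" "R x = y"
    using orthogonal_transformation_exists assms(2) by blast
  have [measurable]: "R \<in> borel_measurable borel"
    using R by (intro borel_measurable_orthogonal)
  have "(\<integral>u. g (u \<bullet> x) \<partial>sphere_measure) = (\<integral>u. g (R u \<bullet> y) \<partial>sphere_measure)"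
    using R by (auto simp: orthogonal_transformation_def)
  also have "\<dots> = (\<integral>u. g (u \<bullet> y) \<partial>distr sphere_measure borel R)"
    by (subst integral_distr) auto
  finally show ?thesis
    by (simp add: distr_sphere_measure_orthogonal[OF R(1)])
qed

lemma AE_abs_inner_le:
  assumes "norm y = 1"
  shows "AE u in sphere_measure. \<bar>u \<bullet> y\<bar> \<le> 1"
  using AE_sphere_measure
  by eventually_elim (metis Cauchy_Schwarz_ineq2 assms mult_1)

lemma integrable_sphere_measure:
  fixes f :: "real ^ 3 \<Rightarrow> real"
  assumes f: "continuous_on UNIV f"
  shows "integrable sphere_measure f"
proof -
  have "compact (f ` sphere 0 1)"
    using f by (intro compact_continuous_image) (auto intro: continuous_on_subset)
  then obtain B where "\<forall>z\<in>f ` sphere 0 1. norm z \<le> B"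
    using compact_imp_bounded bounded_iff by metis
  moreover have "f \<in> borel_measurable sphere_measure"
    using borel_measurable_continuous_onI[OF f] by simp
  ultimately show ?thesis
    using AE_sphere_measure
    by (intro sphere_measure.integrable_const_bound[where B=B]) (auto elim!: eventually_mono)
qed

section \<open>Moments of the inner product with a unit vector\<close>

definition moment :: "nat \<Rightarrow> real" where
  "moment k = (\<integral>u. (u \<bullet> axis 1 1) ^ k \<partial>sphere_measure)"

lemma moment_eq:
  assumes "norm y = 1"
  shows "(\<integral>u. (u \<bullet> y) ^ k \<partial>sphere_measure) = moment k"
  unfolding moment_def by (rule integral_sphere_measure_inner_cong) (use assms in auto)

lemma integral_inner_power:
  "(\<integral>u. (u \<bullet> y) ^ k \<partial>sphere_measure) = moment k * norm y ^ k"
proof (cases "y = 0")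
  case False
  have "(\<integral>u. (u \<bullet> y) ^ k \<partial>sphere_measure) = (\<integral>u. (u \<bullet> sgn y) ^ k * norm y ^ k \<partial>sphere_measure)"
    using False by (simp add: sgn_div_norm power_divide field_simps)
  then show ?thesis
    using False by (simp add: moment_eq norm_sgn)
qed (cases k; simp add: moment_def)

lemma moment_0: "moment 0 = 1"
  using sphere_measure.prob_space by (simp add: moment_def)

lemma moment_odd:
  assumes "odd k"
  shows "moment k = 0"
proof -
  have "moment k = (\<integral>u. (u \<bullet> - axis 1 1) ^ k \<partial>sphere_measure)"
    by (rule moment_eq[symmetric]) simp
  also have "\<dots> = - moment k"
    using assms by (simp add: moment_def)
  finally show ?thesis by simp
qed

text \<open>Compares the coefficients of \<open>t\<^sup>2\<close> in \<open>\<integral> (u \<bullet> (a + t b))\<^sup>k d\<sigma>(u) = moment k * (1 + t\<^sup>2)\<^bsup>k/2\<^esup>\<close>, where \<open>k = 2 * Suc j\<close>.\<close>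

lemma integral_inner_power_mult_square:
  assumes "norm a = 1" "norm b = 1" "a \<bullet> b = 0"
  shows "real (2 * Suc j choose 2) * (\<integral>u. (u \<bullet> a) ^ (2 * j) * (u \<bullet> b)\<^sup>2 \<partial>sphere_measure)
    = real (Suc j) * moment (2 * Suc j)"
proof -
  let ?k = "2 * Suc j"
  let ?A = "\<lambda>i. real (?k choose i) * (\<integral>u. (u \<bullet> a) ^ (?k - i) * (u \<bullet> b) ^ i \<partial>sphere_measure)"
  let ?B = "\<lambda>i. if even i then moment ?k * real (Suc j choose (i div 2)) else 0"
  have "(\<Sum>i\<le>?k. ?A i * t ^ i) = (\<Sum>i\<le>?k. ?B i * t ^ i)" for t :: real
  proof -
    have int: "integrable sphere_measure (\<lambda>u. (u \<bullet> a) ^ p * (u \<bullet> b) ^ q)" for p q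
      by (intro integrable_sphere_measure continuous_intros)
    have "(\<Sum>i\<le>?k. ?A i * t ^ i) =
      (\<Sum>i\<le>?k. \<integral>u. real (?k choose i) * t ^ i * ((u \<bullet> a) ^ (?k - i) * (u \<bullet> b) ^ i) \<partial>sphere_measure)"
      unfolding Bochner_Integration.integral_mult_right_zero by (intro sum.cong refl) (simp only: mult_ac)
    also have "\<dots> = (\<integral>u. (\<Sum>i\<le>?k. real (?k choose i) * t ^ i * ((u \<bullet> a) ^ (?k - i) * (u \<bullet> b) ^ i)) \<partial>sphere_measure)"
      using int by (intro Bochner_Integration.integral_sum[symmetric]) simp
    also have "\<dots> = (\<integral>u. (u \<bullet> (t *\<^sub>R b + a)) ^ ?k \<partial>sphere_measure)"
      unfolding inner_add_right inner_scaleR_right binomial_ring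
      by (simp add: mult_ac power_mult_distrib)
    also have "\<dots> = moment ?k * ((norm (t *\<^sub>R b + a))\<^sup>2) ^ Suc j"
      unfolding integral_inner_power by (simp only: power_mult)
    also have "(norm (t *\<^sub>R b + a))\<^sup>2 = t\<^sup>2 + 1"
      unfolding power2_norm_eq_inner using assms
      by (simp add: inner_add_left inner_add_right inner_commute power2_eq_square norm_eq_1)
    also have "moment ?k * (t\<^sup>2 + 1) ^ Suc j = (\<Sum>i\<le>Suc j. moment ?k * real (Suc j choose i) * t ^ (2 * i))"
      unfolding binomial_ring sum_distrib_left
      by (simp only: power_one mult_1_right power_mult mult.assoc)
    also have "\<dots> = (\<Sum>i\<in>{i. even i \<and> i \<le> ?k}. ?B i * t ^ i)"
      by (rule sum.reindex_bij_witness[of _ "\<lambda>i. i div 2" "\<lambda>i. 2 * i"]) auto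
    also have "\<dots> = (\<Sum>i\<le>?k. ?B i * t ^ i)"
      by (rule sum.mono_neutral_left) auto
    finally show ?thesis .
  qed
  then have "\<forall>i\<le>?k. ?A i = ?B i"
    by (intro polyfun_eq_coeffs[THEN iffD1] allI)
  then have "?A 2 = ?B 2"
    by (elim allE[of _ 2] impE) simp_all
  moreover have "?k - 2 = 2 * j"
    by simp
  ultimately show ?thesis
    by (simp add: mult.commute del: mult_Suc_right)
qed

text \<open>Insert \<open>1 = \<Sum>i. (u \<bullet> e i)^2\<close> into the integral for
  \<open>moment (2 * j)\<close>. The term \<open>i = 1\<close> is the next moment; each of the other
  two is that moment divided by \<open>2 * j + 1\<close>.\<close>

lemma moment_Suc_Suc: "(2 * real j + 3) * moment (2 * Suc j) = (2 * real j + 1) * moment (2 * j)"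
proof -
  let ?e = "\<lambda>i. axis i 1 :: real ^ 3"
  have int: "integrable sphere_measure (\<lambda>u. (u \<bullet> ?e 1) ^ p * (u \<bullet> ?e i) ^ q)" for p q i
    by (intro integrable_sphere_measure continuous_intros)
  have mixed: "(\<integral>u. (u \<bullet> ?e 1) ^ (2 * j) * (u \<bullet> ?e i)\<^sup>2 \<partial>sphere_measure) = moment (2 * Suc j) / (2 * real j + 1)" if "i \<noteq> 1" for i
  proof -
    have "real (2 * Suc j choose 2) * (\<integral>u. (u \<bullet> ?e 1) ^ (2 * j) * (u \<bullet> ?e i)\<^sup>2 \<partial>sphere_measure)
      = real (Suc j) * moment (2 * Suc j)"
      by (rule integral_inner_power_mult_square) (use that in \<open>auto simp: inner_axis_axis\<close>)
    moreover have "real (2 * Suc j choose 2) = real (Suc j) * (2 * real j + 1)"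
      by (simp add: choose_two algebra_simps)
    ultimately have "real (Suc j) * ((2 * real j + 1) * (\<integral>u. (u \<bullet> ?e 1) ^ (2 * j) * (u \<bullet> ?e i)\<^sup>2 \<partial>sphere_measure))
      = real (Suc j) * moment (2 * Suc j)"
      by (simp only: mult.assoc)
    then show ?thesis
      by (simp only: mult_cancel_left) (simp add: eq_divide_eq mult.commute)
  qed
  have "moment (2 * j) = (\<integral>u. (\<Sum>i\<in>UNIV. (u \<bullet> ?e 1) ^ (2 * j) * (u \<bullet> ?e i)\<^sup>2) \<partial>sphere_measure)"
    unfolding moment_def
  proof (rule integral_cong_AE)
    show "AE u in sphere_measure. (u \<bullet> ?e 1) ^ (2 * j) = (\<Sum>i\<in>UNIV. (u \<bullet> ?e 1) ^ (2 * j) * (u \<bullet> ?e i)\<^sup>2)"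
      using AE_sphere_measure
    proof eventually_elim
      case (elim u)
      then have "(\<Sum>i\<in>UNIV. (u \<bullet> ?e i)\<^sup>2) = 1"
        by (simp add: norm_eq_1 inner_vec_def[of u u] inner_axis power2_eq_square)
      then show ?case
        by (simp only: sum_distrib_left[symmetric] mult_1_right)
    qed
  qed measurable
  also have "\<dots> = (\<Sum>i\<in>UNIV. \<integral>u. (u \<bullet> ?e 1) ^ (2 * j) * (u \<bullet> ?e i)\<^sup>2 \<partial>sphere_measure)"
    by (intro Bochner_Integration.integral_sum int)
  also have "\<dots> = moment (2 * Suc j) + 2 * moment (2 * Suc j) / (2 * real j + 1)"
  proof -
    have "(\<integral>u. (u \<bullet> ?e 1) ^ (2 * j) * (u \<bullet> ?e 1)\<^sup>2 \<partial>sphere_measure) = moment (2 * Suc j)"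
      by (simp add: moment_def flip: power_add)
    then show ?thesis
      unfolding sum_3 by (subst (1 2) mixed) simp_all
  qed
  finally show ?thesis
    by (simp add: field_simps)
qed

text \<open>These are the moments of the uniform distribution on \<open>{-1..1}\<close>, in
  accordance with Archimedes' theorem that a coordinate is uniformly distributed on the
  sphere.\<close>

lemma moment: "moment k = (if even k then 1 / real (Suc k) else 0)"
proof -
  have "moment (2 * j) = 1 / real (2 * j + 1)" for j
  proof (induction j)
    case (Suc j)
    have "(2 * real j + 3) * moment (2 * Suc j) = 1"
      unfolding moment_Suc_Suc Suc by (simp add: field_simps)
    then show ?case
      by (simp add: field_simps)
  qed (simp add: moment_0)
  from this[of "k div 2"] show ?thesis
    by (cases "even k") (simp_all add: moment_odd)
qed

section \<open>Mean distance to a point of the sphere\<close>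

lemma norm_diff_eq_sqrt:
  fixes x y :: "'a::real_inner"
  assumes "norm x = 1" "norm y = 1"
  shows "norm (x - y) = sqrt 2 * sqrt (1 - x \<bullet> y)"
proof -
  have "norm (x - y) = sqrt (2 * (1 - x \<bullet> y))"
    using assms by (simp add: norm_eq_sqrt_inner inner_diff_left inner_diff_right inner_commute)
  then show ?thesis
    by (simp only: real_sqrt_mult)
qed

text \<open>Equal moments give equal series, so the value computed for the uniform distribution on
  \<open>{-1..1}\<close> carries over.\<close>

lemma integral_norm_diff:
  assumes "norm y = 1"
  shows "(\<integral>u. norm (u - y) \<partial>sphere_measure) = 4 / 3"
proof -
  have "(\<lambda>k. sqrt_coeff k * (\<integral>u. (u \<bullet> y) ^ k \<partial>sphere_measure)) sums
      (\<integral>u. - sqrt (1 - u \<bullet> y) \<partial>sphere_measure)"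
    by (rule moment_series)
      (use AE_abs_inner_le[OF assms] in \<open>auto intro: sphere_measure.prob_space_axioms\<close>)
  then have "(\<integral>u. - sqrt (1 - u \<bullet> y) \<partial>sphere_measure) = - 4 / (3 * sqrt 2)"
    using uniform_moment_series unfolding moment_eq[OF assms] moment by (rule sums_unique2)
  moreover have "(\<integral>u. norm (u - y) \<partial>sphere_measure) = (\<integral>u. sqrt 2 * sqrt (1 - u \<bullet> y) \<partial>sphere_measure)"
    by (rule integral_cong_AE)
      (use AE_sphere_measure in \<open>auto elim!: eventually_mono simp: norm_diff_eq_sqrt assms\<close>)
  ultimately show ?thesis
    by (simp add: field_simps)
qed

section \<open>The sum of distances of a finite point set\<close>

text \<open>Indexing by words in the basis vectors, not by exponents, keeps multinomial coefficients
  out of the expansion of \<open>(x \<bullet> y) ^ k\<close>.\<close>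

definition monomial :: "'a::euclidean_space list \<Rightarrow> 'a \<Rightarrow> real" where
  "monomial bs x = (\<Prod>b\<leftarrow>bs. x \<bullet> b)"

text \<open>The kernel is an inner product of tensor powers, which makes it positive
  definite.\<close>

lemma inner_power_eq_sum_monomial:
  fixes x y :: "'a::euclidean_space"
  shows "(x \<bullet> y) ^ k = (\<Sum>bs | set bs \<subseteq> Basis \<and> length bs = k. monomial bs x * monomial bs y)"
proof (induction k)
  case 0
  have "{bs. set bs \<subseteq> (Basis :: 'a set) \<and> length bs = 0} = {[]}"
    by auto
  then show ?case
    by (simp add: monomial_def)
next
  case (Suc k)
  let ?L = "\<lambda>k. {bs. set bs \<subseteq> (Basis :: 'a set) \<and> length bs = k}"
  have "(x \<bullet> y) ^ Suc k = (\<Sum>bs\<in>?L k. monomial bs x * monomial bs y) * (\<Sum>b\<in>Basis. (x \<bullet> b) * (y \<bullet> b))"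
    unfolding Suc[symmetric] euclidean_inner[symmetric] by simp
  also have "\<dots> = (\<Sum>(bs, b)\<in>?L k \<times> Basis. monomial (b # bs) x * monomial (b # bs) y)"
    unfolding sum_product sum.cartesian_product by (rule sum.cong) (auto simp: monomial_def mult_ac)
  also have "\<dots> = (\<Sum>bs\<in>(\<lambda>(bs, b). b # bs) ` (?L k \<times> Basis). monomial bs x * monomial bs y)"
    by (subst sum.reindex) (auto simp: inj_on_def case_prod_unfold intro!: sum.cong)
  also have "(\<lambda>(bs, b). b # bs) ` (?L k \<times> Basis) = ?L (Suc k)"
    by (auto simp: length_Suc_conv image_iff)
  finally show ?case .
qed

lemma continuous_on_monomial: "continuous_on UNIV (monomial bs)"
  unfolding monomial_def by (induction bs) (auto intro!: continuous_intros)

text \<open>Positive definiteness of \<open>(x \<bullet> y)\<^sup>k\<close>, applied to the signed measure \<open>\<Sum>\<^sub>i \<delta>\<^bsub>x\<^sub>i\<^esub> - N \<sigma>\<close>.\<close>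

lemma moment_le_sum_inner_power:
  fixes x :: "'i \<Rightarrow> real ^ 3"
  assumes x: "\<And>i. i \<in> I \<Longrightarrow> norm (x i) = 1"
  shows "real (card I) ^ 2 * moment k \<le> (\<Sum>i\<in>I. \<Sum>j\<in>I. (x i \<bullet> x j) ^ k)"
proof -
  let ?L = "{bs. set bs \<subseteq> (Basis :: (real ^ 3) set) \<and> length bs = k}"
  let ?N = "real (card I)"
  define c where "c bs = (\<integral>u. monomial bs u \<partial>sphere_measure)" for bs
  have int: "integrable sphere_measure (monomial bs)" for bs
    by (intro integrable_sphere_measure continuous_on_monomial)
  \<comment> \<open>By rotation invariance, integrating the kernel in one variable leaves a
    constant.\<close>
  have avg: "(\<Sum>bs\<in>?L. monomial bs y * c bs) = moment k" if "norm y = 1" for y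
  proof -
    have "(\<Sum>bs\<in>?L. monomial bs y * c bs) = (\<integral>u. (\<Sum>bs\<in>?L. monomial bs u * monomial bs y) \<partial>sphere_measure)"
      using int by (subst Bochner_Integration.integral_sum) (simp_all add: c_def mult.commute)
    then show ?thesis
      using that by (simp add: inner_power_eq_sum_monomial[symmetric] moment_eq)
  qed
  have "(\<Sum>bs\<in>?L. c bs * c bs) = (\<integral>u. (\<Sum>bs\<in>?L. monomial bs u * c bs) \<partial>sphere_measure)"
    using int by (subst Bochner_Integration.integral_sum) (simp_all add: c_def)
  also have "\<dots> = (\<integral>u. moment k \<partial>sphere_measure)"
  proof (rule integral_cong_AE)
    show "(\<lambda>u. \<Sum>bs\<in>?L. monomial bs u * c bs) \<in> borel_measurable sphere_measure"
      by (intro borel_measurable_integrable Bochner_Integration.integrable_sum) (simp add: int)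
    show "AE u in sphere_measure. (\<Sum>bs\<in>?L. monomial bs u * c bs) = moment k"
      using AE_sphere_measure by eventually_elim (rule avg)
  qed simp
  finally have cc: "(\<Sum>bs\<in>?L. c bs * c bs) = moment k"
    using sphere_measure.prob_space by simp
  \<comment> \<open>Expanding the squares, the cross term is \<open>- 2 * ?N^2 * moment k\<close>
    and the last one \<open>?N^2 * moment k\<close>.\<close>
  have "0 \<le> (\<Sum>bs\<in>?L. ((\<Sum>i\<in>I. monomial bs (x i)) - ?N * c bs)\<^sup>2)"
    by (intro sum_nonneg) simp
  also have "\<dots> = (\<Sum>bs\<in>?L. (\<Sum>i\<in>I. \<Sum>j\<in>I. monomial bs (x i) * monomial bs (x j))
      - 2 * ?N * (\<Sum>i\<in>I. monomial bs (x i) * c bs) + ?N\<^sup>2 * (c bs * c bs))"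
    unfolding sum_product[symmetric] sum_distrib_right[symmetric]
    by (simp add: power2_eq_square algebra_simps)
  also have "\<dots> = (\<Sum>bs\<in>?L. \<Sum>i\<in>I. \<Sum>j\<in>I. monomial bs (x i) * monomial bs (x j))
      - 2 * ?N * (\<Sum>bs\<in>?L. \<Sum>i\<in>I. monomial bs (x i) * c bs) + ?N\<^sup>2 * (\<Sum>bs\<in>?L. c bs * c bs)"
    by (simp add: sum.distrib sum_subtractf sum_distrib_left[symmetric])
  also have "(\<Sum>bs\<in>?L. \<Sum>i\<in>I. \<Sum>j\<in>I. monomial bs (x i) * monomial bs (x j)) = (\<Sum>i\<in>I. \<Sum>j\<in>I. (x i \<bullet> x j) ^ k)"
    unfolding inner_power_eq_sum_monomial
    by (rule trans[OF sum.swap]) (intro sum.cong refl sum.swap)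
  also have "(\<Sum>bs\<in>?L. \<Sum>i\<in>I. monomial bs (x i) * c bs) = ?N * moment k"
    by (subst sum.swap) (simp add: avg x)
  finally show ?thesis
    unfolding cc by (simp add: power2_eq_square algebra_simps)
qed

text \<open>The diagonal terms are 1 and, for even \<open>k\<close>, the others are
  nonnegative.\<close>

lemma card_le_sum_inner_power:
  fixes x :: "'i \<Rightarrow> 'a::real_inner"
  assumes x: "\<And>i. i \<in> I \<Longrightarrow> norm (x i) = 1" and "finite I" "even k"
  shows "real (card I) \<le> (\<Sum>i\<in>I. \<Sum>j\<in>I. (x i \<bullet> x j) ^ k)"
proof -
  have "real (card I) = (\<Sum>i\<in>I. (x i \<bullet> x i) ^ k)"
    using x by (simp add: norm_eq_1)
  also have "\<dots> \<le> (\<Sum>i\<in>I. \<Sum>j\<in>I. (x i \<bullet> x j) ^ k)"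
    using assms by (intro sum_mono member_le_sum) (auto simp: zero_le_even_power)
  finally show ?thesis .
qed

text \<open>The constant comes from \<open>16 * (4 * t)^3 = (32 * t * sqrt t)^2\<close>.\<close>

lemma sqrt_coeff_ge:
  assumes "1 \<le> k" "real k \<le> 4 * t"
  shows "1 / (32 * t * sqrt t) \<le> sqrt_coeff k"
proof -
  have t: "t > 0"
    using assms by linarith
  have c: "0 \<le> sqrt_coeff k"
    using assms sqrt_coeff_nonneg[of "k - 1"] by simp
  have "1 \<le> 16 * real k ^ 3 * (sqrt_coeff k)\<^sup>2"
    using assms by (intro sqrt_coeff_lower)
  also have "\<dots> \<le> 16 * (4 * t) ^ 3 * (sqrt_coeff k)\<^sup>2"
    using assms by (intro mult_right_mono mult_left_mono power_mono) auto
  also have "\<dots> = (32 * t * sqrt t * sqrt_coeff k)\<^sup>2"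
    using t by (simp add: power_mult_distrib power2_eq_square power3_eq_cube)
  finally have "1\<^sup>2 \<le> (32 * t * sqrt t * sqrt_coeff k)\<^sup>2"
    by simp
  then have "1 \<le> 32 * t * sqrt t * sqrt_coeff k"
    by (rule power2_le_imp_le) (use t c in simp)
  then show ?thesis
    using t by (simp add: divide_le_eq mult.commute)
qed

text \<open>The deficit, divided by \<open>sqrt 2\<close>, is the sum of the series
  \<open>d\<close>. Its terms are nonnegative, and at least \<open>N\<close> of them are at least
  \<open>1 / (64 * sqrt N)\<close>. The factor \<open>sqrt 2\<close> is finally estimated by
  1.\<close>

theorem sum_distances_le:
  fixes x :: "'i \<Rightarrow> real ^ 3"
  assumes x: "\<And>i. i \<in> I \<Longrightarrow> norm (x i) = 1" and I: "finite I"
  shows "(\<Sum>i\<in>I. \<Sum>j\<in>I. norm (x i - x j)) \<le> 4 / 3 * real (card I) ^ 2 - sqrt (card I) / 64"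
proof (cases "I = {}")
  case False
  define N where "N = card I"
  define S where "S k = (\<Sum>i\<in>I. \<Sum>j\<in>I. (x i \<bullet> x j) ^ k)" for k
  define E where "E = (\<Sum>i\<in>I. \<Sum>j\<in>I. sqrt (1 - x i \<bullet> x j))"
  define d where "d k = sqrt_coeff k * (S k - (real N)\<^sup>2 * moment k)" for k
  have N: "N \<ge> 1"
    using False I by (simp add: N_def Suc_le_eq card_gt_0_iff)
  have "(\<lambda>k. \<Sum>i\<in>I. \<Sum>j\<in>I. sqrt_coeff k * (x i \<bullet> x j) ^ k) sums (\<Sum>i\<in>I. \<Sum>j\<in>I. - sqrt (1 - x i \<bullet> x j))"
  proof (intro sums_sum sqrt_coeff_sums)
    fix i j assume "i \<in> I" "j \<in> I"
    then show "\<bar>x i \<bullet> x j\<bar> \<le> 1"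
      using Cauchy_Schwarz_ineq2[of "x i" "x j"] by (simp add: x)
  qed
  then have "(\<lambda>k. sqrt_coeff k * S k) sums (- E)"
    by (simp add: S_def E_def sum_distrib_left sum_negf)
  moreover have "(\<lambda>k. (real N)\<^sup>2 * (sqrt_coeff k * moment k)) sums ((real N)\<^sup>2 * (- 4 / (3 * sqrt 2)))"
    using uniform_moment_series unfolding moment by (rule sums_mult)
  ultimately have "(\<lambda>k. sqrt_coeff k * S k - (real N)\<^sup>2 * (sqrt_coeff k * moment k)) sums
      (- E - (real N)\<^sup>2 * (- 4 / (3 * sqrt 2)))"
    by (rule sums_diff)
  then have d_sums: "d sums ((real N)\<^sup>2 * 4 / (3 * sqrt 2) - E)"
    by (simp add: d_def[abs_def] right_diff_distrib mult_ac)
  \<comment> \<open>The negative coefficient at \<open>k = 0\<close> is harmless because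
    \<open>S 0 = N^2\<close> makes \<open>d 0\<close> vanish.\<close>
  have d_nonneg: "0 \<le> d k" for k
  proof (cases k)
    case 0
    then show ?thesis
      by (simp add: d_def S_def moment_0 N_def power2_eq_square)
  next
    case (Suc l)
    then show ?thesis
      using moment_le_sum_inner_power[of I x k] sqrt_coeff_nonneg[of l] x
      by (simp add: d_def S_def N_def)
  qed
  \<comment> \<open>The lower end of the range keeps the mean part at most \<open>N / 2\<close>,
    against at least \<open>N\<close> from the diagonal; the upper end gives
    \<open>2 * j \<le> 4 * N\<close>, which bounds the coefficient from below.\<close>
  have d_lower: "1 / (64 * sqrt N) \<le> d (2 * j)" if "j \<in> {N..2 * N}" for j
  proof -
    have "real N * (2 * real N) \<le> real N * (2 * real j + 1)"
      using that by (intro mult_left_mono) auto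
    then have "(real N)\<^sup>2 * moment (2 * j) \<le> real N / 2"
      by (simp add: moment power2_eq_square field_simps)
    moreover have "real N \<le> S (2 * j)"
      unfolding S_def N_def using x I by (intro card_le_sum_inner_power) auto
    ultimately have *: "real N / 2 \<le> S (2 * j) - (real N)\<^sup>2 * moment (2 * j)"
      by linarith
    have "1 / (32 * real N * sqrt N) \<le> sqrt_coeff (2 * j)"
      using that N by (intro sqrt_coeff_ge) auto
    then have "1 / (32 * real N * sqrt N) * (real N / 2) \<le> d (2 * j)"
      unfolding d_def using * by (intro mult_mono) (auto intro: order_trans[rotated])
    then show ?thesis
      using N by simp
  qed
  have "sqrt N / 64 = real N * (1 / (64 * sqrt N))"
    using N by (simp add: field_simps)
  also have "\<dots> \<le> real (card {N..2 * N}) * (1 / (64 * sqrt N))"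
    by (intro mult_right_mono) auto
  also have "\<dots> \<le> (\<Sum>j\<in>{N..2 * N}. d (2 * j))"
    using d_lower by (intro sum_bounded_below) auto
  also have "\<dots> = sum d ((\<lambda>j. 2 * j) ` {N..2 * N})"
    by (simp add: sum.reindex inj_on_def)
  also have "\<dots> \<le> suminf d"
    using d_sums d_nonneg by (intro sum_le_suminf) (auto simp: sums_iff)
  also have "\<dots> = (real N)\<^sup>2 * 4 / (3 * sqrt 2) - E"
    using d_sums by (simp add: sums_iff)
  finally have "sqrt 2 * (sqrt N / 64) \<le> sqrt 2 * ((real N)\<^sup>2 * 4 / (3 * sqrt 2) - E)"
    by (intro mult_left_mono) auto
  moreover have "sqrt N / 64 \<le> sqrt 2 * (sqrt N / 64)"
    using mult_right_mono[of 1 "sqrt 2" "sqrt N / 64"] by simp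
  moreover have "(\<Sum>i\<in>I. \<Sum>j\<in>I. norm (x i - x j)) = sqrt 2 * E"
    unfolding E_def sum_distrib_left by (intro sum.cong refl norm_diff_eq_sqrt x)
  ultimately show ?thesis
    by (simp add: N_def right_diff_distrib)
qed simp

section \<open>Maxima of the potentials\<close>

lemma dist_potential_le_max_potential:
  assumes "norm y = 1"
  shows "dist_potential x n y \<le> max_potential x n"
  using assms by (auto intro: max_potential_attained[of x n])

lemma continuous_on_dist_potential: "continuous_on UNIV (dist_potential x n)"
  unfolding dist_potential_def[abs_def] by (intro continuous_intros)

lemma dist_potential_Suc: "dist_potential x (Suc n) y = dist_potential x n y + norm (y - x (Suc n))"
  by (simp add: dist_potential_def)

lemma integral_dist_potential:
  assumes "\<And>i. 1 \<le> i \<Longrightarrow> norm (x i) = 1"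
  shows "(\<integral>u. dist_potential x n u \<partial>sphere_measure) = 4 * real n / 3"
proof -
  have "(\<integral>u. dist_potential x n u \<partial>sphere_measure) = (\<Sum>i=1..n. \<integral>u. norm (u - x i) \<partial>sphere_measure)"
    unfolding dist_potential_def
    by (intro Bochner_Integration.integral_sum integrable_sphere_measure continuous_intros)
  then show ?thesis
    using assms by (simp add: integral_norm_diff)
qed

text \<open>Weighting the two nonnegative gaps by \<open>r = norm (u - y)\<close> and
  \<open>2 - r\<close> cancels the product of \<open>r\<close> with the potential. Only the means of
  \<open>r\<close>, \<open>r^2\<close> and the potential remain: \<open>4 / 3\<close>, 2 and
  \<open>4 * n / 3\<close>.\<close>

lemma max_potential_step:
  assumes x: "\<And>i. 1 \<le> i \<Longrightarrow> norm (x i) = 1"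
  shows "2 / 9 \<le> 4 / 3 * (max_potential x (Suc n) - 4 * real (Suc n) / 3)
    + 2 / 3 * (max_potential x n - 4 * real n / 3)"
proof -
  define y where "y = x (Suc n)"
  have y: "norm y = 1"
    using x by (simp add: y_def)
  let ?M = "max_potential x"
  let ?P = "dist_potential x"
  have int: "integrable sphere_measure (\<lambda>u. norm (u - y))" "integrable sphere_measure (?P n)"
    "integrable sphere_measure (\<lambda>u. (norm (u - y))\<^sup>2)"
    by (intro integrable_sphere_measure continuous_intros continuous_on_dist_potential)+
  have "(\<integral>u. (norm (u - y))\<^sup>2 \<partial>sphere_measure) = (\<integral>u. 2 - 2 * (u \<bullet> y) ^ 1 \<partial>sphere_measure)"
  proof (rule integral_cong_AE)
    show "AE u in sphere_measure. (norm (u - y))\<^sup>2 = 2 - 2 * (u \<bullet> y) ^ 1"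
      using AE_sphere_measure
    proof eventually_elim
      case (elim u)
      then show ?case
        using y by (simp add: power2_norm_eq_inner norm_eq_1 inner_diff_left inner_diff_right inner_commute)
    qed
  qed auto
  also have "\<dots> = 2 - 2 * (\<integral>u. (u \<bullet> y) ^ 1 \<partial>sphere_measure)"
    using sphere_measure.prob_space
    by (subst Bochner_Integration.integral_diff) (auto intro!: integrable_sphere_measure continuous_intros)
  also have "\<dots> = 2"
    unfolding moment_eq[OF y] by (simp add: moment)
  finally have sq: "(\<integral>u. (norm (u - y))\<^sup>2 \<partial>sphere_measure) = 2" .
  have "0 \<le> (\<integral>u. (?M (Suc n) - ?M n) * norm (u - y) + 2 * ?M n - (norm (u - y))\<^sup>2 - 2 * ?P n u \<partial>sphere_measure)"
  proof (rule integral_nonneg_AE)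
    show "AE u in sphere_measure. 0 \<le> (?M (Suc n) - ?M n) * norm (u - y) + 2 * ?M n - (norm (u - y))\<^sup>2 - 2 * ?P n u"
      using AE_sphere_measure
    proof eventually_elim
      case (elim u)
      have "norm (u - y) \<le> 2"
        using norm_triangle_ineq4[of u y] elim y by simp
      then have "0 \<le> norm (u - y) * (?M (Suc n) - ?P (Suc n) u) + (2 - norm (u - y)) * (?M n - ?P n u)"
        using elim by (intro add_nonneg_nonneg mult_nonneg_nonneg)
          (auto simp: dist_potential_le_max_potential)
      then show ?case
        by (simp add: dist_potential_Suc y_def[symmetric] power2_eq_square algebra_simps)
    qed
  qed
  also have "\<dots> = (?M (Suc n) - ?M n) * (4 / 3) + 2 * ?M n - 2 - 2 * (4 * real n / 3)"
    using int sphere_measure.prob_space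
    by (simp add: sq integral_norm_diff[OF y] integral_dist_potential[OF x])
  finally show ?thesis
    by (simp add: field_simps)
qed

lemma sum_max_potential_ge:
  assumes x: "\<And>i. 1 \<le> i \<Longrightarrow> norm (x i) = 1"
  shows "real N / 9 \<le> (\<Sum>n=1..N. max_potential x n - 4 * real n / 3)"
proof -
  define d where "d n = max_potential x n - 4 * real n / 3" for n
  have d_nonneg: "0 \<le> d N"
  proof -
    have "(\<integral>u. dist_potential x N u \<partial>sphere_measure) \<le> (\<integral>u. max_potential x N \<partial>sphere_measure)"
    proof (rule integral_mono_AE)
      show "AE u in sphere_measure. dist_potential x N u \<le> max_potential x N"
        using AE_sphere_measure by eventually_elim (rule dist_potential_le_max_potential)
    qed (auto intro: integrable_sphere_measure continuous_on_dist_potential)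
    then show ?thesis
      using sphere_measure.prob_space by (simp add: integral_dist_potential[OF x] d_def)
  qed
  \<comment> \<open>Adding up the step inequalities, with \<open>d 0 = 0\<close>, counts every
    \<open>d n\<close> twice except the last, which lacks \<open>2 / 3 * d N\<close>. This boundary
    term is nonnegative and is dropped afterwards.\<close>
  have "2 / 9 * real N + 2 / 3 * d N \<le> 2 * (\<Sum>n=1..N. d n)"
  proof (induction N)
    case 0
    then show ?case
      by (simp add: d_def max_potential_def dist_potential_def)
  next
    case (Suc N)
    have "2 / 9 \<le> 4 / 3 * d (Suc N) + 2 / 3 * d N"
      unfolding d_def by (rule max_potential_step[OF x])
    moreover have "(\<Sum>n=1..Suc N. d n) = (\<Sum>n=1..N. d n) + d (Suc N)"
      by simp
    ultimately show ?case
      using Suc by (simp add: field_simps)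
  qed
  then show ?thesis
    using d_nonneg unfolding d_def[symmetric] by linarith
qed

section \<open>Upper bound from the energy of the sequence\<close>

text \<open>Each pair is counted once on the left, when its later point is added; the diagonal is
  zero.\<close>

lemma sum_dist_potential:
  "2 * (\<Sum>n=1..K. dist_potential x n (x (Suc n))) = (\<Sum>i=1..Suc K. \<Sum>j=1..Suc K. norm (x i - x j))"
proof (induction K)
  case (Suc K)
  have "(\<Sum>i=1..Suc (Suc K). \<Sum>j=1..Suc (Suc K). norm (x i - x j)) =
      (\<Sum>i=1..Suc K. \<Sum>j=1..Suc K. norm (x i - x j)) + 2 * (\<Sum>i=1..Suc K. norm (x (Suc (Suc K)) - x i))"
    by (simp add: sum.distrib norm_minus_commute)
  then show ?case
    using Suc by (simp add: dist_potential_def)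
qed simp

text \<open>From \<open>n = m\<close> on, the maximum is attained at the next point. Each of the
  fewer than \<open>m\<close> earlier indices costs at most \<open>2 * m\<close>, since distances
  are at most 2.\<close>

lemma sum_max_potential_le:
  assumes x: "greedy_sequence m x"
  shows "(\<Sum>n=1..K. max_potential x n - 4 * real n / 3)
    \<le> 2 / 3 * real (Suc K) + 2 * real m ^ 2 - sqrt (Suc K) / 128"
proof -
  have unit: "norm (x i) = 1" if "1 \<le> i" for i
    using x that by (auto simp: greedy_sequence_def)
  have "max_potential x n \<le> dist_potential x n (x (Suc n)) + (if n < m then 2 * real m else 0)" for n
  proof (cases "n < m")
    case True
    obtain y where y: "norm y = 1" "max_potential x n = dist_potential x n y"
      using max_potential_attained[of x n] by auto
    have "dist_potential x n y \<le> (\<Sum>i=1..n. 2)"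
      unfolding dist_potential_def
    proof (rule sum_mono)
      fix i assume "i \<in> {1..n}"
      then show "norm (y - x i) \<le> 2"
        using norm_triangle_ineq4[of y "x i"] y unit[of i] by simp
    qed
    moreover have "0 \<le> dist_potential x n (x (Suc n))"
      by (simp add: dist_potential_def sum_nonneg)
    ultimately show ?thesis
      using True y by simp
  next
    case False
    obtain y where "y \<in> S2" "max_potential x n = dist_potential x n y"
      using max_potential_attained[of x n] by auto
    then show ?thesis
      using x False by (auto simp: greedy_sequence_def is_arg_max_linorder)
  qed
  then have "(\<Sum>n=1..K. max_potential x n) \<le>
      (\<Sum>n=1..K. dist_potential x n (x (Suc n))) + (\<Sum>n=1..K. if n < m then 2 * real m else 0)"
    by (simp add: sum_mono flip: sum.distrib)
  also have "(\<Sum>n=1..K. if n < m then 2 * real m else 0) \<le> (\<Sum>n<m. 2 * real m)"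
    unfolding sum.inter_filter[OF finite_atLeastAtMost, symmetric] by (rule sum_mono2) auto
  also have "\<dots> = 2 * real m ^ 2"
    by (simp add: power2_eq_square)
  finally have "(\<Sum>n=1..K. max_potential x n) \<le> (\<Sum>n=1..K. dist_potential x n (x (Suc n))) + 2 * real m ^ 2"
    by simp
  moreover have "2 * (\<Sum>n=1..K. dist_potential x n (x (Suc n))) \<le> 4 / 3 * real (Suc K) ^ 2 - sqrt (Suc K) / 64"
    unfolding sum_dist_potential using sum_distances_le[of "{1..Suc K}" x] unit by simp
  \<comment> \<open>The linear term of this sum produces the constant \<open>2 / 3\<close> of the
    upper bound.\<close>
  moreover have "(\<Sum>n=1..K. 4 * real n / 3) = 2 / 3 * real (Suc K) ^ 2 - 2 / 3 * real (Suc K)"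
    by (induction K) (simp_all add: power2_eq_square field_simps)
  ultimately show ?thesis
    unfolding sum_subtractf by linarith
qed

theorem proposition2p2:
  fixes m :: nat
  assumes "m \<ge> 1"
  shows "\<exists>N0::nat. \<forall>x :: nat \<Rightarrow> real ^ 3. greedy_sequence m x \<longrightarrow>
    (\<forall>N\<ge>N0.
       1 / 25 \<le> (1 / real N) * (\<Sum>n=1..N-1. (max_potential x n - 4 * real n / 3)) \<and>
       (1 / real N) * (\<Sum>n=1..N-1. (max_potential x n - 4 * real n / 3)) \<le> 2 / 3)"
proof (intro exI allI impI)
  fix x :: "nat \<Rightarrow> real ^ 3" and N :: nat
  \<comment> \<open>The square makes \<open>sqrt N / 128\<close> at least \<open>2 * m^2\<close>,
    absorbing the initial points. The summand 2 ensures \<open>N \<ge> 2\<close>, whence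
    \<open>(N - 1) / 9 \<ge> N / 25\<close>. The threshold depends on \<open>m\<close>
    alone.\<close>
  assume x: "greedy_sequence m x" and N: "(256 * m\<^sup>2)\<^sup>2 + 2 \<le> N"
  let ?S = "\<Sum>n=1..N-1. (max_potential x n - 4 * real n / 3)"
  have "real (N - 1) / 9 \<le> ?S"
    by (rule sum_max_potential_ge) (use x in \<open>auto simp: greedy_sequence_def\<close>)
  then have "1 / 25 * real N \<le> ?S"
    using N by (simp add: of_nat_diff)
  moreover have "256 * real m ^ 2 \<le> sqrt N"
  proof (rule real_le_rsqrt)
    have "real ((256 * m\<^sup>2)\<^sup>2) \<le> real N"
      using N by (intro of_nat_mono) simp
    then show "(256 * real m ^ 2)\<^sup>2 \<le> real N"
      by simp
  qed
  then have "?S \<le> 2 / 3 * real N"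
    using sum_max_potential_le[OF x, of "N - 1"] N by simp
  ultimately show "1 / 25 \<le> (1 / real N) * ?S \<and> (1 / real N) * ?S \<le> 2 / 3"
    using N by (simp add: field_simps)
qed

end
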